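(* Let $\boldsymbol{x}=[\boldsymbol{x}_1^\top,\ldots,\boldsymbol{x}_M^\top]^\top:[0,\tau]\to\mathbb{R}^{NM}$ and $\boldsymbol{\lambda}:[0,\tau]\to\mathbb{R}^N$ be differentiable and satisfy, for all $\theta\in[0,\tau]$ and all $m\in\{1,\ldots,M\}$, the dynamical system $$\dot{\boldsymbol{x}}_m(\theta)=-\Big(b_m(\theta)\nabla_m^2 f+\sum_{n=1}^N\lambda_n\nabla_m^2 h_{m,n}\Big)^{-1}\boldsymbol{\mathcal{J}}_m\Big(\dot{\boldsymbol{\lambda}}-\frac{\dot b_m(\theta)}{b_m(\theta)}\boldsymbol{\lambda}\Big),$$ $$\boldsymbol{\lambda}=-b_m(\theta)\,\boldsymbol{\mathcal{J}}_m^{-1}\nabla_m f,\qquad \sum_{k=1}^M\boldsymbol{\mathcal{J}}_k^\top\,\dot{\boldsymbol{x}}_k(\theta)=\boldsymbol{0}.$$ Put $c_m(\theta):=\dot b_m(\theta)/b_m(\theta)$ and $\boldsymbol{c}(\theta)=[c_1(\theta),\ldots,c_M(\theta)]^\top$. Then the system can be re-parameterized as the following linear combination of $c_1(\theta),\ldots,c_M(\theta)$: $$\dot{\boldsymbol{x}}(\theta)=\boldsymbol{\Gamma}(\theta)\,\boldsymbol{c}(\theta),\qquad \theta\in[0,\tau],$$ where $$\boldsymbol{\Gamma}(\theta)=\begin{pmatrix}\boldsymbol{\gamma}_{11}&\cdots&\boldsymbol{\gamma}_{1M}\\ \vdots& &\vdots\\ \boldsymbol{\gamma}_{M1}&\cdots&\boldsymbol{\gamma}_{MM}\end{pmatrix}\in\mathbb{R}^{NM\times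 M},$$ and, for $n,m\in\{1,\ldots,M\}$, $$\boldsymbol{\gamma}_{nm}=-G_n^{-1}\bigg(\Big(\sum_{k=1}^M D_k\Big)^{-1}D_m-\delta_{nm}\boldsymbol{I}\bigg)\boldsymbol{1}\in\mathbb{R}^N,$$ $$G_n=\mathrm{diag}(\boldsymbol{v}^{(n)})^{-1}\boldsymbol{\mathcal{J}}_n^{-1}\Big(\nabla_n^2 f+\sum_{j=1}^N v^{(n)}_j\nabla_n^2 h_{n,j}\Big),\qquad D_m=\boldsymbol{\mathcal{J}}_m^\top G_m^{-1},\qquad \boldsymbol{v}^{(m)}=-\boldsymbol{\mathcal{J}}_m^{-1}\nabla_m f.$$
   Context: $N,M$ are positive integers, $\tau>0$. The functions $f:\mathbb{R}^N\to\mathbb{R}$ and $\boldsymbol{h}_m=[h_{m,1},\ldots,h_{m,N}]^\top:\mathbb{R}^N\to\mathbb{R}^N$ ($m=1,\ldots,M$) are twice continuously differentiable. The functions $b_m:[0,\tau]\to\mathbb{R}$ are differentiable and nowhere zero. The dot denotes the derivative with respect to $\theta$. Notation along a curve: $\nabla_m f$ and $\nabla_m^2 f$ are the gradient and Hessian of $f$ evaluated at $\boldsymbol{x}_m(\theta)$; $\nabla_m^2 h_{m,n}$ is the Hessian of $h_{m,n}$ evaluated at $\boldsymbol{x}_m(\theta)$; $\boldsymbol{\mathcal{J}}_m\in\mathbb{R}^{N\times N}$ is the transpose of the Jacobian matrix of $\boldsymbol{h}_m$ at $\boldsymbol{x}_m(\theta)$. $\boldsymbol{\lambda}=[\lambda_1,\ldots,\lambda_N]^\top$,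 $\boldsymbol{v}^{(m)}=[v^{(m)}_1,\ldots,v^{(m)}_N]^\top$. $\boldsymbol{I}$ is the $N\times N$ identity matrix, $\boldsymbol{1}\in\mathbb{R}^N$ the all-ones vector, $\delta_{nm}$ the Kronecker delta, and $\mathrm{diag}(\boldsymbol{v})$ the diagonal matrix with diagonal $\boldsymbol{v}$. Standing assumptions: for all $\theta\in[0,\tau]$, all matrices whose inverses appear are invertible, i.e. $\boldsymbol{\mathcal{J}}_m$, $\mathrm{diag}(\boldsymbol{v}^{(m)})$, and $\nabla_m^2 f+\sum_{j=1}^N v^{(m)}_j\nabla_m^2 h_{m,j}$ for every $m\in\{1,\ldots,M\}$, as well as $\sum_{k=1}^M D_k$. *)

theory Defs
  imports "HOL-Analysis.Analysis"
begin

definition gradient :: "(real^'n \<Rightarrow> real) \<Rightarrow> real^'n \<Rightarrow> real^'n" where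
  "gradient f y = (\<chi> i. frechet_derivative f (at y) (axis i 1))"

definition hessian :: "(real^'n \<Rightarrow> real) \<Rightarrow> real^'n \<Rightarrow> real^'n^'n" where
  "hessian f y = jacobian (gradient f) (at y)"

definition twice_cont_diff :: "(real^'n \<Rightarrow> real) \<Rightarrow> bool" where
  "twice_cont_diff f \<longleftrightarrow>
     (\<forall>y. f differentiable (at y)) \<and>
     (\<forall>y. gradient f differentiable (at y)) \<and>
     continuous_on UNIV (hessian f)"

definition diag_mat :: "real^'n \<Rightarrow> real^'n^'n" where
  "diag_mat v = (\<chi> i j. if i = j then v $ i else 0)"

text \<open>The derivative of a curve on the interval from 0 to \<open>\<tau>\<close>; it is one-sided at the
  endpoints, and values of the curve outside the interval play no role there.\<close>

definition curve_deriv :: "real \<Rightarrow> (real \<Rightarrow> 'a::real_normed_vector) \<Rightarrow> real \<Rightarrow> 'a" where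
  "curve_deriv \<tau> g \<theta> = vector_derivative g (at \<theta> within {0..\<tau>})"

text \<open>A stacked vector of \<open>M\<close> blocks of length \<open>N\<close> is indexed by pairs (block number, position
  within the block), with \<open>M = CARD('m)\<close> and \<open>N = CARD('n)\<close>.\<close>

definition block :: "'m::finite \<Rightarrow> real^('m \<times> 'n) \<Rightarrow> real^'n" where
  "block m z = (\<chi> i. z $ (m, i))"

text \<open>In the following, \<open>h\<close> is a single map on the Euclidean \<open>N\<close>-space and \<open>y\<close> is the point at
  which all derivatives are evaluated.\<close>

definition jacT :: "(real^'n \<Rightarrow> real^'n) \<Rightarrow> real^'n \<Rightarrow> real^'n^'n" where
  "jacT h y = transpose (jacobian h (at y))"

definition v_vec :: "(real^'n \<Rightarrow> real) \<Rightarrow> (real^'n \<Rightarrow> real^'n) \<Rightarrow> real^'n \<Rightarrow> real^'n" where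
  "v_vec f h y = - (matrix_inv (jacT h y) *v gradient f y)"

definition comb_hessian ::
  "real \<Rightarrow> real^'n \<Rightarrow> (real^'n \<Rightarrow> real) \<Rightarrow> (real^'n \<Rightarrow> real^'n) \<Rightarrow> real^'n \<Rightarrow> real^'n^'n" where
  "comb_hessian \<beta> u f h y =
     \<beta> *\<^sub>R hessian f y + (\<Sum>j\<in>UNIV. (u $ j) *\<^sub>R hessian (\<lambda>z. h z $ j) y)"

definition G_mat :: "(real^'n \<Rightarrow> real) \<Rightarrow> (real^'n \<Rightarrow> real^'n) \<Rightarrow> real^'n \<Rightarrow> real^'n^'n" where
  "G_mat f h y =
     matrix_inv (diag_mat (v_vec f h y)) ** matrix_inv (jacT h y) **
     comb_hessian 1 (v_vec f h y) f h y"

definition D_mat :: "(real^'n \<Rightarrow> real) \<Rightarrow> (real^'n \<Rightarrow> real^'n) \<Rightarrow> real^'n \<Rightarrow> real^'n^'n" where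
  "D_mat f h y = transpose (jacT h y) ** matrix_inv (G_mat f h y)"

definition gamma_vec ::
  "(real^'n \<Rightarrow> real) \<Rightarrow> ('m::finite \<Rightarrow> real^'n \<Rightarrow> real^'n) \<Rightarrow> real^('m \<times> 'n) \<Rightarrow> 'm \<Rightarrow> 'm \<Rightarrow> real^'n"
  where
  "gamma_vec f h z n m =
     - (matrix_inv (G_mat f (h n) (block n z)) *v
         ((matrix_inv (\<Sum>k\<in>UNIV. D_mat f (h k) (block k z)) ** D_mat f (h m) (block m z)
            - (if n = m then mat 1 else 0)) *v vec 1))"

definition Gamma_mat ::
  "(real^'n \<Rightarrow> real) \<Rightarrow> ('m::finite \<Rightarrow> real^'n \<Rightarrow> real^'n) \<Rightarrow> real^('m \<times> 'n) \<Rightarrow> real^'m^('m \<times> 'n)"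
  where
  "Gamma_mat f h z = (\<chi> p m. gamma_vec f h z (fst p) m $ snd p)"

end

theory Submission
  imports Defs
begin

text \<open>The second equation says \<open>\<lambda> = b\<^sub>m v\<^sup>m\<close> for every \<open>m\<close>, so the matrix inverted in the first one is
  \<open>b\<^sub>m\<close> times that of \<open>G\<^sub>m\<close>, and the first equation becomes
  \<open>x\<^sub>m' = - G\<^sub>m\<inverse> (w - c\<^sub>m 1)\<close>, where the vector \<open>w\<close> of logarithmic derivatives of the entries of \<open>\<lambda>\<close>
  does not depend on \<open>m\<close>. The third equation then reads \<open>(\<Sum>k. D\<^sub>k) w = \<Sum>k. c\<^sub>k D\<^sub>k 1\<close>, which
  determines \<open>w\<close>.\<close>

lemma
  fixes A :: "real^'n^'n"
  assumes "invertible A"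
  shows matrix_inv_left: "matrix_inv A ** A = mat 1"
    and matrix_inv_right: "A ** matrix_inv A = mat 1"
  using someI_ex[OF assms[unfolded invertible_def]] by (simp_all add: matrix_inv_def)

text \<open>Trades an inverse for a linear equation, so that the arguments below never need a
  formula for the inverse of a product.\<close>

lemma matrix_inv_vector_eq_iff:
  fixes A :: "real^'n^'n"
  assumes "invertible A"
  shows "matrix_inv A *v p = q \<longleftrightarrow> p = A *v q"
  using matrix_inv_left[OF assms] matrix_inv_right[OF assms]
  by (metis matrix_vector_mul_assoc matrix_vector_mul_lid)

lemma invertible_matrix_inv:
  fixes A :: "real^'n^'n"
  shows "invertible A \<Longrightarrow> invertible (matrix_inv A)"
  using matrix_inv_left matrix_inv_right invertible_def by blast

lemma matrix_vector_mult_sum: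
  fixes A :: "real^'n^'n"
  shows "A *v (\<Sum>k\<in>K. u k) = (\<Sum>k\<in>K. A *v u k)"
  by (rule linear_sum[OF matrix_vector_mul_linear])

lemma sum_matrix_vector_mult:
  fixes A :: "'k \<Rightarrow> real^'n^'n"
  shows "(\<Sum>k\<in>K. A k) *v u = (\<Sum>k\<in>K. A k *v u)"
  by (induction K rule: infinite_finite_induct) (simp_all add: matrix_vector_mult_add_rdistrib)

lemma matrix_vector_mult_minus:
  fixes A :: "real^'n^'n"
  shows "A *v (- u) = - (A *v u)"
  by (rule linear_neg[OF matrix_vector_mul_linear])

lemma diag_mat_vector: "(diag_mat v *v u) $ i = v $ i * u $ i"
  by (simp add: diag_mat_def matrix_vector_mult_def if_distrib if_distribR cong: if_cong)

text \<open>If entry \<open>i\<close> of \<open>v\<close> vanished, so would entry \<open>i\<close>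
  of every vector in the range of \<open>diag_mat v\<close>; but invertibility puts
  \<open>axis i 1\<close> in that range.\<close>

lemma invertible_diag_mat_nonzero:
  fixes v :: "real^'n"
  assumes "invertible (diag_mat v)"
  shows "v $ i \<noteq> 0"
proof
  assume "v $ i = 0"
  then have "(diag_mat v *v (matrix_inv (diag_mat v) *v axis i 1)) $ i = 0"
    by (simp add: diag_mat_vector)
  moreover have "diag_mat v *v (matrix_inv (diag_mat v) *v axis i 1) = axis i 1"
    using matrix_inv_vector_eq_iff[OF assms] by metis
  ultimately show False by (simp add: axis_def)
qed

lemma comb_hessian_scale:
  "comb_hessian \<beta> (\<beta> *\<^sub>R u) f h y = \<beta> *\<^sub>R comb_hessian 1 u f h y"
  by (simp add: comb_hessian_def scaleR_add_right scaleR_sum_right)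

lemma invertible_G_mat:
  assumes "invertible (jacT h y)" "invertible (diag_mat (v_vec f h y))"
    and "invertible (comb_hessian 1 (v_vec f h y) f h y)"
  shows "invertible (G_mat f h y)"
  unfolding G_mat_def by (intro invertible_mult invertible_matrix_inv assms)

text \<open>With H the combination for \<beta> = 1, G = diag(v)^-1 J^-1 H gives H^-1 J = G^-1
  diag(v)^-1. The factor \<beta> comes out of the Hessian combination and joins the diagonal matrix,
  whose inverse is entrywise division.\<close>

lemma matrix_inv_comb_hessian_eq_G_mat:
  assumes J: "invertible (jacT h y)" and V: "invertible (diag_mat (v_vec f h y))"
    and H: "invertible (comb_hessian 1 (v_vec f h y) f h y)" and b: "\<beta> \<noteq> 0"
  shows "matrix_inv (comb_hessian \<beta> (\<beta> *\<^sub>R v_vec f h y) f h y) *v (jacT h y *v p) =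
         matrix_inv (G_mat f h y) *v (\<chi> i. p $ i / (\<beta> * v_vec f h y $ i))"
proof -
  define v where "v = v_vec f h y"
  define H1 where "H1 = comb_hessian 1 v f h y"
  define q :: "real^'a" where "q = (\<chi> i. p $ i / (\<beta> * v $ i))"
  define r where "r = matrix_inv (G_mat f h y) *v q"
  \<comment> \<open>\<open>r\<close> is the claimed value. Peeling off the inverses inside G one at
    a time shows that it solves the linear system defining the left-hand side.\<close>
  have "q = G_mat f h y *v r"
    using matrix_inv_vector_eq_iff[OF invertible_G_mat[OF J V H]] r_def by metis
  then have "matrix_inv (diag_mat v) *v (matrix_inv (jacT h y) *v (H1 *v r)) = q"
    by (simp add: G_mat_def v_def H1_def matrix_vector_mul_assoc matrix_mul_assoc)
  then have "matrix_inv (jacT h y) *v (H1 *v r) = diag_mat v *v q"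
    using V by (simp add: matrix_inv_vector_eq_iff v_def)
  then have Hr: "H1 *v r = jacT h y *v (diag_mat v *v q)"
    using J by (simp add: matrix_inv_vector_eq_iff)
  have "\<beta> *\<^sub>R (diag_mat v *v q) = p"
    using b invertible_diag_mat_nonzero[OF V]
    by (simp add: vec_eq_iff diag_mat_vector q_def v_def)
  then have "jacT h y *v p = (\<beta> *\<^sub>R H1) *v r"
    using Hr by (metis matrix_vector_mult_scaleR scaleR_matrix_vector_assoc)
  moreover have "invertible (\<beta> *\<^sub>R H1)"
    using H b by (simp add: H1_def v_def scalar_invertible_iff)
  ultimately show ?thesis
    using matrix_inv_vector_eq_iff comb_hessian_scale r_def q_def H1_def v_def by metis
qed

text \<open>Taking a block is bounded linear, hence commutes with differentiation. Since \<tau> > 0,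
  the derivative within the interval is unique, also at the endpoints, so the choice made by
  \<open>vector_derivative\<close> is forced.\<close>

lemma curve_deriv_block:
  fixes x :: "real \<Rightarrow> real^('m::finite \<times> 'n::finite)"
  assumes "\<tau> > 0" "\<theta> \<in> {0..\<tau>}" "x differentiable (at \<theta> within {0..\<tau>})"
  shows "curve_deriv \<tau> (\<lambda>t. block m (x t)) \<theta> = block m (curve_deriv \<tau> x \<theta>)"
proof -
  have "bounded_linear (block m :: real^('m \<times> 'n) \<Rightarrow> real^'n)"
    unfolding linear_conv_bounded_linear[symmetric]
    by (rule linearI) (simp_all add: block_def vec_eq_iff)
  then have "((\<lambda>t. block m (x t)) has_vector_derivative block m (curve_deriv \<tau> x \<theta>))
      (at \<theta> within {0..\<tau>})"
    using assms(3) bounded_linear.has_vector_derivative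
    unfolding curve_deriv_def vector_derivative_works by blast
  then show ?thesis
    using assms unfolding curve_deriv_def
    by (intro vector_derivative_within_closed_interval) auto
qed

theorem theorem1:
  fixes \<tau> :: real
    and f :: "real^'n \<Rightarrow> real"
    and h :: "'m::finite \<Rightarrow> real^'n \<Rightarrow> real^'n"
    and b :: "'m \<Rightarrow> real \<Rightarrow> real"
    and x :: "real \<Rightarrow> real^('m \<times> 'n)"
    and lam :: "real \<Rightarrow> real^'n"
  assumes tau_pos: "\<tau> > 0"
    and f_C2: "twice_cont_diff f"
    and h_C2: "\<And>m n. twice_cont_diff (\<lambda>y. h m y $ n)"
    and b_diff: "\<And>m \<theta>. \<theta> \<in> {0..\<tau>} \<Longrightarrow> b m differentiable (at \<theta> within {0..\<tau>})"
    and b_nz: "\<And>m \<theta>. \<theta> \<in> {0..\<tau>} \<Longrightarrow> b m \<theta> \<noteq> 0"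
    and J_inv: "\<And>m \<theta>. \<theta> \<in> {0..\<tau>} \<Longrightarrow> invertible (jacT (h m) (block m (x \<theta>)))"
    and diag_inv: "\<And>m \<theta>. \<theta> \<in> {0..\<tau>} \<Longrightarrow>
           invertible (diag_mat (v_vec f (h m) (block m (x \<theta>))))"
    and H_inv: "\<And>m \<theta>. \<theta> \<in> {0..\<tau>} \<Longrightarrow>
           invertible (comb_hessian 1 (v_vec f (h m) (block m (x \<theta>))) f (h m) (block m (x \<theta>)))"
    and D_inv: "\<And>\<theta>. \<theta> \<in> {0..\<tau>} \<Longrightarrow>
           invertible (\<Sum>k\<in>UNIV. D_mat f (h k) (block k (x \<theta>)))"
    and x_diff: "\<And>\<theta>. \<theta> \<in> {0..\<tau>} \<Longrightarrow> x differentiable (at \<theta> within {0..\<tau>})"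
    and lam_diff: "\<And>\<theta>. \<theta> \<in> {0..\<tau>} \<Longrightarrow> lam differentiable (at \<theta> within {0..\<tau>})"
    and sys_x: "\<And>m \<theta>. \<theta> \<in> {0..\<tau>} \<Longrightarrow>
           curve_deriv \<tau> (\<lambda>t. block m (x t)) \<theta> =
             - (matrix_inv (comb_hessian (b m \<theta>) (lam \<theta>) f (h m) (block m (x \<theta>))) *v
                 (jacT (h m) (block m (x \<theta>)) *v
                   (curve_deriv \<tau> lam \<theta> - (curve_deriv \<tau> (b m) \<theta> / b m \<theta>) *\<^sub>R lam \<theta>)))"
    and sys_lam: "\<And>m \<theta>. \<theta> \<in> {0..\<tau>} \<Longrightarrow>
           lam \<theta> = - (b m \<theta> *\<^sub>R (matrix_inv (jacT (h m) (block m (x \<theta>))) *v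
                              gradient f (block m (x \<theta>))))"
    and sys_sum: "\<And>\<theta>. \<theta> \<in> {0..\<tau>} \<Longrightarrow>
           (\<Sum>k\<in>UNIV. transpose (jacT (h k) (block k (x \<theta>))) *v
                       curve_deriv \<tau> (\<lambda>t. block k (x t)) \<theta>) = 0"
  shows "\<forall>\<theta>\<in>{0..\<tau>}.
           curve_deriv \<tau> x \<theta> =
             Gamma_mat f h (x \<theta>) *v (\<chi> m. curve_deriv \<tau> (b m) \<theta> / b m \<theta>)"
proof
  fix \<theta> assume t: "\<theta> \<in> {0..\<tau>}"
  define y where "y m = block m (x \<theta>)" for m
  define G where "G m = G_mat f (h m) (y m)" for m
  define D where "D m = D_mat f (h m) (y m)" for m
  define S where "S = (\<Sum>k\<in>UNIV. D k)"
  define c where "c m = curve_deriv \<tau> (b m) \<theta> / b m \<theta>" for m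
  define w :: "real^'n" where "w = (\<chi> i. curve_deriv \<tau> lam \<theta> $ i / lam \<theta> $ i)"
  have lam: "lam \<theta> = b m \<theta> *\<^sub>R v_vec f (h m) (y m)" for m
    using sys_lam[OF t, of m] by (simp add: v_vec_def y_def)
  \<comment> \<open>Makes the divisions in \<open>w\<close> genuine. Any one block suffices, so the
    index is taken to be \<open>undefined\<close>.\<close>
  have lam_nz: "lam \<theta> $ i \<noteq> 0" for i
    using b_nz[OF t] invertible_diag_mat_nonzero[OF diag_inv[OF t]] lam[of undefined]
    by (simp add: y_def)
  have x': "curve_deriv \<tau> (\<lambda>t. block m (x t)) \<theta> = - (matrix_inv (G m) *v (w - c m *\<^sub>R vec 1))" for m
  proof -
    let ?p = "curve_deriv \<tau> lam \<theta> - c m *\<^sub>R lam \<theta>"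
    have "matrix_inv (comb_hessian (b m \<theta>) (lam \<theta>) f (h m) (y m)) *v (jacT (h m) (y m) *v ?p)
        = matrix_inv (G m) *v (\<chi> i. ?p $ i / lam \<theta> $ i)"
      using matrix_inv_comb_hessian_eq_G_mat[OF J_inv[OF t] diag_inv[OF t] H_inv[OF t] b_nz[OF t],
          of m m ?p] lam[of m]
      by (simp add: G_def y_def)
    \<comment> \<open>Entrywise division by \<lambda> turns the multiple of \<lambda> into a
      multiple of the all-ones vector; this isolates the dependence on \<open>m\<close> in
      \<open>c m\<close>.\<close>
    moreover have "(\<chi> i. ?p $ i / lam \<theta> $ i) = w - c m *\<^sub>R vec 1"
      using lam_nz by (simp add: vec_eq_iff w_def diff_divide_distrib)
    ultimately show ?thesis
      using sys_x[OF t, of m] by (simp add: c_def y_def)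
  qed
  have inv_S: "invertible S"
    using D_inv[OF t] by (simp add: S_def D_def y_def)
  \<comment> \<open>The transposed Jacobian factor merges with G^-1 into \<open>D k\<close>, and the
    common minus sign drops out.\<close>
  have "(\<Sum>k\<in>UNIV. D k *v (w - c k *\<^sub>R vec 1)) = 0"
    using sys_sum[OF t]
    by (simp add: x' D_def D_mat_def G_def y_def matrix_vector_mult_minus sum_negf
        matrix_vector_mul_assoc)
  then have "S *v w = (\<Sum>k\<in>UNIV. c k *\<^sub>R (D k *v vec 1))"
    by (simp add: S_def matrix_vector_mult_diff_distrib matrix_vector_mult_scaleR sum_subtractf
        sum_matrix_vector_mult)
  then have "w = matrix_inv S *v (\<Sum>k\<in>UNIV. c k *\<^sub>R (D k *v vec 1))"
    by (rule matrix_inv_vector_eq_iff[OF inv_S, THEN iffD2, OF sym, THEN sym])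
  also have "\<dots> = (\<Sum>k\<in>UNIV. c k *\<^sub>R ((matrix_inv S ** D k) *v vec 1))"
    by (simp add: matrix_vector_mult_sum matrix_vector_mult_scaleR matrix_vector_mul_assoc)
  finally have w: "w = (\<Sum>k\<in>UNIV. c k *\<^sub>R ((matrix_inv S ** D k) *v vec 1))" .
  have "curve_deriv \<tau> x \<theta> $ (n, i) = (\<Sum>m\<in>UNIV. gamma_vec f h (x \<theta>) n m $ i * c m)" for n i
  proof -
    \<comment> \<open>The Kronecker delta places the term \<open>c n\<close> times the all-ones
      vector inside the sum over \<open>m\<close>, which produces the columns of \<Gamma>.\<close>
    have "w - c n *\<^sub>R vec 1 =
        (\<Sum>m\<in>UNIV. c m *\<^sub>R ((matrix_inv S ** D m - (if n = m then mat 1 else 0)) *v vec 1))"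
      by (subst w) (simp add: matrix_vector_mult_diff_rdistrib scaleR_diff_right sum_subtractf
          if_distrib[of "\<lambda>A. _ *\<^sub>R (A *v _)"] cong: if_cong)
    then have "block n (curve_deriv \<tau> x \<theta>) = (\<Sum>m\<in>UNIV. c m *\<^sub>R gamma_vec f h (x \<theta>) n m)"
      using x'[of n] curve_deriv_block[OF tau_pos t x_diff[OF t], of n]
      by (simp add: gamma_vec_def G_def S_def D_def y_def matrix_vector_mult_sum
          matrix_vector_mult_scaleR sum_negf)
    from arg_cong[OF this, of "\<lambda>u. u $ i"] show ?thesis
      by (simp add: block_def mult.commute)
  qed
  then show "curve_deriv \<tau> x \<theta> =
      Gamma_mat f h (x \<theta>) *v (\<chi> m. curve_deriv \<tau> (b m) \<theta> / b m \<theta>)"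
    by (simp add: vec_eq_iff Gamma_mat_def matrix_vector_mult_def c_def)
qed

end
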